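(* Let $\alpha\in\mathbb{R}$ and $(u_n)_{n\ge1}=S(0,\alpha,1)$, i.e. $u_1=1$, $u_n=\alpha u_{n-1}+\sum_{j=1}^{n-1}u_ju_{n-j}$ for $n\ge2$. Then the sequence is regular if $\alpha\ge0$, quasiregular if $-1\le\alpha<0$, and not simply represented if $\alpha<-1$.
   Context: The generating function is $F(z)=\frac{z+\alpha-\sqrt{z^2+2(2+\alpha)z+\alpha^2}}{2z}=\sum_{n\ge1}(-1)^nu_nz^{-n}$ for $|z|$ large, with the square root positive for large positive $z$, continued analytically. The sequence is simply represented if (i) $F$ continues to a single-valued function on $\mathbb{C}\setminus(-\infty,0]$ whose only singularities there are simple poles, and (ii) $\lim_{z\to0}zF(z)$ exists and is finite. A simply represented sequence is regular if moreover (i* ) $F$ has no singularities in $\mathbb{C}\setminus(-\infty,0]$ and (ii* ) $\lim_{z\to0}zF(z)=0$; it is quasiregular if it satisfies (ii) but not (ii* ). (Adding a constant to $F$ does not affect these notions.) *)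

theory Defs
  imports "HOL-Complex_Analysis.Complex_Analysis"
begin

text \<open>
  Sequences are indexed from 1: the value \<open>u 0\<close> is never used.
\<close>

abbreviation slit_plane :: "complex set" where
  "slit_plane \<equiv> - \<real>\<^sub>\<le>\<^sub>0"

text \<open>
  \<open>continues_gen_fun u G\<close>: the series \<open>F(z) = (\<Sum>n\<ge>1. (-1)^n u\<^sub>n z^(-n))\<close> converges for all
  large \<open>z\<close> in the slit plane and \<open>G\<close> is a meromorphic continuation of its sum to the whole slit
  plane. Being nicely meromorphic means that \<open>G\<close> is analytic at every point that is
  not a pole (removable singularities are removed), so \<open>G\<close> is determined by \<open>u\<close> on the slit plane;
  its values on the cut are irrelevant.
\<close>
definition continues_gen_fun :: "(nat \<Rightarrow> real) \<Rightarrow> (complex \<Rightarrow> complex) \<Rightarrow> bool" where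
  "continues_gen_fun u G \<longleftrightarrow>
     G nicely_meromorphic_on slit_plane \<and>
     (\<forall>\<^sub>F z in at_infinity. z \<in> slit_plane \<longrightarrow>
        (\<lambda>n. (-1) ^ Suc n * complex_of_real (u (Suc n)) / z ^ Suc n) sums G z)"

definition simply_represented :: "(nat \<Rightarrow> real) \<Rightarrow> bool" where
  "simply_represented u \<longleftrightarrow>
     (\<exists>G. continues_gen_fun u G \<and>
          (\<forall>p\<in>slit_plane. is_pole G p \<longrightarrow> zorder G p = -1) \<and>
          (\<exists>L. ((\<lambda>z. z * G z) \<longlongrightarrow> L) (at 0 within slit_plane)))"

definition regular_seq :: "(nat \<Rightarrow> real) \<Rightarrow> bool" where
  "regular_seq u \<longleftrightarrow>
     simply_represented u \<and>
     (\<exists>G. continues_gen_fun u G \<and>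
          G holomorphic_on slit_plane \<and>
          ((\<lambda>z. z * G z) \<longlongrightarrow> 0) (at 0 within slit_plane))"

definition quasiregular_seq :: "(nat \<Rightarrow> real) \<Rightarrow> bool" where
  "quasiregular_seq u \<longleftrightarrow>
     simply_represented u \<and>
     (\<exists>G. continues_gen_fun u G \<and>
          \<not> ((\<lambda>z. z * G z) \<longlongrightarrow> 0) (at 0 within slit_plane))"

end

theory Submission
  imports Defs
begin

text \<open>
  With \<open>w = -1/z\<close> the recurrence says that the generating function \<open>f\<close> satisfies
  \<open>f = w + \<alpha>wf + f\<^sup>2\<close>, whose solution as a power series vanishing at 0 is unique. Hence
  \<open>(2zF - z - \<alpha>)\<^sup>2 = (z + \<alpha>)\<^sup>2 + 4z\<close>, with branch points \<open>-(1 \<plusminus> s)\<^sup>2\<close> where \<open>s\<^sup>2 = 1 + \<alpha>\<close>.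
  For \<open>\<alpha> \<ge> -1\<close> they lie on the cut, the root factors into two principal square roots, and
  \<open>zF(z)\<close> tends to \<open>(\<alpha> - \<bar>\<alpha>\<bar>)/2\<close> at 0. For \<open>\<alpha> < -1\<close> they are simple zeros off the cut of a
  polynomial which would have to be the square of a function analytic there.
\<close>

section \<open>Power series solutions of the quadratic equation\<close>

text \<open>Comparing coefficients turns the equation into the recurrence. As the constant term is
  0, the terms j = 0 and j = n of the convolution vanish, so only earlier coefficients occur and
  strong induction applies.\<close>

lemma fps_quadratic_nth:
  fixes \<alpha> :: real and u :: "nat \<Rightarrow> real" and F :: "complex fps"
  assumes u1: "u 1 = 1"
    and u: "\<And>n. n \<ge> 2 \<Longrightarrow> u n = \<alpha> * u (n - 1) + (\<Sum>j = 1..n - 1. u j * u (n - j))"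
    and F0: "fps_nth F 0 = 0"
    and F: "F = fps_X + fps_const (of_real \<alpha>) * (fps_X * F) + F * F"
  shows "n \<ge> 1 \<Longrightarrow> fps_nth F n = of_real (u n)"
proof (induction n rule: less_induct)
  case (less n)
  have Fn: "fps_nth F n = fps_nth (fps_X + fps_const (of_real \<alpha>) * (fps_X * F) + F * F) n"
    using F by simp
  show ?case
  proof (cases "n = 1")
    case True
    have "fps_nth (F * F) 1 = 0"
      by (simp add: fps_mult_nth F0)
    with True Fn u1 show ?thesis by (simp add: F0)
  next
    case False
    with less.prems have n: "n \<ge> 2" by simp
    have "fps_nth (F * F) n = (\<Sum>j=0..n. fps_nth F j * fps_nth F (n - j))"
      by (simp add: fps_mult_nth)
    also have "\<dots> = (\<Sum>j=1..n-1. fps_nth F j * fps_nth F (n - j))"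
      by (rule sum.mono_neutral_right) (auto simp: F0 not_le Suc_le_eq)
    also have "\<dots> = (\<Sum>j=1..n-1. of_real (u j) * of_real (u (n - j)))"
      by (rule sum.cong) (use less.IH n in auto)
    finally have "fps_nth (F * F) n = of_real (\<Sum>j=1..n-1. u j * u (n - j))"
      by simp
    moreover have "fps_nth F (n - 1) = of_real (u (n - 1))"
      using less.IH[of "n - 1"] n by simp
    ultimately show ?thesis
      using Fn n by (simp add: u[OF n] fps_X_nth)
  qed
qed

text \<open>By uniqueness of the power series solution, every analytic branch vanishing at 0 has
  Taylor coefficients \<open>u n\<close>. This lets the two cases use different closed forms of the
  same germ.\<close>

lemma eventually_sums_quadratic_branch:
  fixes \<alpha> :: real and u :: "nat \<Rightarrow> real"
  assumes u1: "u 1 = 1"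
    and u: "\<And>n. n \<ge> 2 \<Longrightarrow> u n = \<alpha> * u (n - 1) + (\<Sum>j = 1..n - 1. u j * u (n - j))"
    and g: "g analytic_on {0}" "g 0 = 0"
    and eq: "\<forall>\<^sub>F w in nhds 0. g w = w + of_real \<alpha> * (w * g w) + g w * g w"
  shows "\<forall>\<^sub>F z in at_infinity.
    (\<lambda>n. (-1) ^ Suc n * complex_of_real (u (Suc n)) / z ^ Suc n) sums g (-1/z)"
proof -
  obtain F where F: "g has_fps_expansion F"
    using analytic_at_imp_has_fps_expansion_0[OF g(1)] by blast
  have F0: "fps_nth F 0 = 0"
    using has_fps_expansion_imp_0_eq_fps_nth_0[OF F] g(2) by simp
  have "(\<lambda>w. w + of_real \<alpha> * (w * g w) + g w * g w) has_fps_expansion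
          fps_X + fps_const (of_real \<alpha>) * (fps_X * F) + F * F"
    by (intro fps_expansion_intros F)
  also have "?this \<longleftrightarrow> g has_fps_expansion fps_X + fps_const (of_real \<alpha>) * (fps_X * F) + F * F"
    by (rule has_fps_expansion_cong) (use eq in \<open>auto elim: eventually_mono\<close>)
  finally have "F = fps_X + fps_const (of_real \<alpha>) * (fps_X * F) + F * F"
    using F fps_expansion_unique_complex by blast
  from fps_quadratic_nth[OF u1 u F0 this]
  have nth: "fps_nth F n = of_real (u n)" if "n \<ge> 1" for n
    using that by blast
  obtain R where R: "R > 0" "g holomorphic_on ball 0 R"
    using g(1) by (auto simp: analytic_on_def)
  have lim: "((\<lambda>z::complex. -1/z) \<longlongrightarrow> 0) at_infinity"
    using tendsto_minus[OF tendsto_inverse_0[where ?'a = complex]] by (simp add: field_simps)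
  have "\<forall>\<^sub>F z in at_infinity. norm (-1/z :: complex) < R"
    using tendstoD[OF lim R(1)] by simp
  thus ?thesis
  proof eventually_elim
    case (elim z)
    have "(\<lambda>n. fps_nth F n * (-1/z)^n) sums g (-1/z)"
      by (rule has_fps_expansion_imp_sums_complex[OF F, of "ereal R"])
         (use R elim in auto)
    \<comment> \<open>The constant term is 0, so shifting the index to start at 1 leaves the sum
      unchanged.\<close>
    hence "(\<lambda>n. fps_nth F (Suc n) * (-1/z)^Suc n) sums g (-1/z)"
      by (subst sums_Suc_iff) (simp add: F0)
    moreover have "(\<lambda>n. fps_nth F (Suc n) * (-1/z)^Suc n) =
        (\<lambda>n. (-1) ^ Suc n * complex_of_real (u (Suc n)) / z ^ Suc n)"
      by (simp add: nth power_divide mult.commute del: power_Suc divide_minus_left)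
    ultimately show ?case by (simp only:)
  qed
qed

section \<open>Principal square roots on the slit plane\<close>

lemma add_nonneg_notin_nonpos_Reals:
  assumes "z \<notin> \<real>\<^sub>\<le>\<^sub>0" "a \<ge> 0"
  shows "z + complex_of_real a \<notin> \<real>\<^sub>\<le>\<^sub>0" "1 + complex_of_real a / z \<notin> \<real>\<^sub>\<le>\<^sub>0"
proof -
  show "z + complex_of_real a \<notin> \<real>\<^sub>\<le>\<^sub>0"
    using assms by (auto simp: complex_nonpos_Reals_iff)
  have z: "z \<noteq> 0" using assms by auto
  show "1 + complex_of_real a / z \<notin> \<real>\<^sub>\<le>\<^sub>0"
  proof
    assume "1 + complex_of_real a / z \<in> \<real>\<^sub>\<le>\<^sub>0"
    then obtain r where r: "r \<le> 0" "1 + complex_of_real a / z = of_real r"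
      by (auto elim!: nonpos_Reals_cases)
    hence "z * of_real (1 - r) = of_real (- a)"
      using z by (simp add: field_simps)
    hence "z = of_real (- a / (1 - r))"
      using r(1) by (simp add: field_simps) 
    moreover have "- a / (1 - r) \<le> 0" using assms(2) r(1) by (simp add: field_simps)
    ultimately show False using assms(1) nonpos_Reals_of_real_iff by blast
  qed
qed

text \<open>Converts roots in 1/z, suited to expansion at infinity, into roots of z + a, whose limit
  at 0 is visible. Principal roots are not multiplicative in general, so the sign of the real part
  of the product has to be checked.\<close>

lemma csqrt_add_nonneg:
  assumes z: "z \<notin> \<real>\<^sub>\<le>\<^sub>0" and a: "a \<ge> 0"
  shows "csqrt (z + complex_of_real a) = csqrt z * csqrt (1 + complex_of_real a / z)"
proof (rule csqrt_unique)
  have z0: "z \<noteq> 0" using z by auto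
  show "(csqrt z * csqrt (1 + complex_of_real a / z))\<^sup>2 = z + complex_of_real a"
    using z0 by (simp add: power_mult_distrib field_simps)
  have pos: "Re (csqrt w) > 0" if "w \<notin> \<real>\<^sub>\<le>\<^sub>0" for w
  proof (rule ccontr)
    assume "\<not> 0 < Re (csqrt w)"
    hence "Re (csqrt w) = 0" using Re_csqrt[of w] by linarith
    hence "(csqrt w)\<^sup>2 = - of_real ((Im (csqrt w))\<^sup>2)"
      by (simp only: complex_eq_iff power2_eq_square times_complex.sel) simp
    hence "w = of_real (- ((Im (csqrt w))\<^sup>2))" by simp
    thus False using that by (metis neg_le_0_iff_le nonpos_Reals_of_real_iff zero_le_power2)
  qed
  let ?q = "1 + complex_of_real a / z"
  have im: "Im ?q = - a * Im z / ((Re z)\<^sup>2 + (Im z)\<^sup>2)"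
    by (simp add: Im_divide)
  have D: "(Re z)\<^sup>2 + (Im z)\<^sup>2 > 0"
    using z0 by (simp add: complex_neq_0)
  \<comment> \<open>\<open>z\<close> and \<open>1 + a/z\<close> lie in opposite closed half planes, so the product of their roots
    stays in the right half plane.\<close>
  have "Im (csqrt z) * Im (csqrt ?q) \<le> 0"
  proof (cases "Im z = 0 \<or> a = 0")
    case True
    thus ?thesis
    proof
      assume "Im z = 0"
      hence "Re z > 0" using z by (auto simp: complex_nonpos_Reals_iff)
      with \<open>Im z = 0\<close> show ?thesis by simp
    qed simp
  next
    case False
    have "sgn (Im ?q) = - sgn (Im z)"
      using False a D unfolding im by (simp add: sgn_divide sgn_mult sgn_minus)
    moreover have "Im ?q \<noteq> 0" unfolding im using False D by simp
    moreover have "Im (csqrt w) = sgn (Im w) * sqrt ((cmod w - Re w) / 2)" if "Im w \<noteq> 0" for w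
      using that by simp
    moreover have "sqrt ((cmod w - Re w) / 2) \<ge> 0" for w
      using complex_Re_le_cmod[of w] by simp
    ultimately have "Im (csqrt z) * Im (csqrt ?q) = 
       - ((sgn (Im z))\<^sup>2 * (sqrt ((cmod z - Re z) / 2) * sqrt ((cmod ?q - Re ?q) / 2)))"
      using False by (simp only: power2_eq_square) simp
    also have "\<dots> \<le> 0"
      using complex_Re_le_cmod[of z] complex_Re_le_cmod[of ?q] 
      by (intro iffD2[OF neg_le_0_iff_le] mult_nonneg_nonneg) auto
    finally show ?thesis .
  qed
  moreover have "Re (csqrt z) * Re (csqrt ?q) > 0"
    using pos[OF z] pos[OF add_nonneg_notin_nonpos_Reals(2)[OF z a]] by simp
  \<comment> \<open>Re(xy) = Re x Re y - Im x Im y, with the first product positive and the second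
    at most 0.\<close>
  ultimately have "Re (csqrt z * csqrt ?q) > 0"
    by (simp only: times_complex.sel)
  thus "0 < Re (csqrt z * csqrt ?q) \<or> Re (csqrt z * csqrt ?q) = 0 \<and> 0 \<le> Im (csqrt z * csqrt ?q)"
    by blast
qed

lemma tendsto_csqrt_add_nonneg:
  assumes "a \<ge> 0"
  shows "((\<lambda>z. csqrt (z + complex_of_real a)) \<longlongrightarrow> of_real (sqrt a)) (at 0)"
proof (cases "a = 0")
  case True
  \<comment> \<open>Here the limit point is the branch point of \<open>csqrt\<close>, so the limit
    is taken through |csqrt z| = sqrt |z|. This case arises for \<alpha> = 0, where one branch point
    is 0.\<close>
  have "((\<lambda>z::complex. sqrt (norm z)) \<longlongrightarrow> sqrt (norm (0::complex))) (at 0)"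
    by (intro tendsto_intros)
  hence "((\<lambda>z. norm (csqrt z)) \<longlongrightarrow> 0) (at 0)" by simp
  hence "(csqrt \<longlongrightarrow> 0) (at 0)" by (rule tendsto_norm_zero_cancel)
  thus ?thesis using True by simp
next
  case False
  with assms have "complex_of_real a \<notin> \<real>\<^sub>\<le>\<^sub>0" by (simp add: complex_nonpos_Reals_iff)
  hence "isCont csqrt (complex_of_real a)" by (rule continuous_at_csqrt)
  moreover have "((\<lambda>z. z + complex_of_real a) \<longlongrightarrow> of_real a) (at 0)"
    by (rule tendsto_eq_intros refl)+ simp
  ultimately have "((\<lambda>z. csqrt (z + complex_of_real a)) \<longlongrightarrow> csqrt (of_real a)) (at 0)"
    by (rule isCont_tendsto_compose)
  thus ?thesis using assms by (simp add: csqrt_of_real)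
qed

text \<open>Makes limits at 0 unique, so that a nonzero limit of z G(z) refutes the limit 0. The
  positive reals already accumulate at 0.\<close>

lemma at_0_within_slit_plane_neq_bot: "at 0 within slit_plane \<noteq> bot"
proof -
  have "complex_of_real ` {0<..} \<subseteq> slit_plane" by (auto simp: complex_nonpos_Reals_iff)
  moreover have "0 islimpt (complex_of_real ` {0<..})"
  proof (rule islimptI)
    fix T :: "complex set" assume "0 \<in> T" "open T"
    then obtain e where e: "e > 0" "ball 0 e \<subseteq> T" by (meson open_contains_ball)
    hence "complex_of_real (e/2) \<in> T" by (auto simp: subset_iff)
    thus "\<exists>y\<in>complex_of_real ` {0<..}. y \<in> T \<and> y \<noteq> 0" using e(1)
      by (intro bexI[of _ "complex_of_real (e/2)"] imageI) auto
  qed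
  ultimately show ?thesis
    using islimpt_subset trivial_limit_within by blast
qed

section \<open>The continuation for \<alpha> >= -1\<close>

text \<open>Each factor 1 + a/z and 1 + b/z avoids the cut of \<open>csqrt\<close>, whereas their
  product can be negative at points off the cut. Hence a product of two roots is used instead of one
  root of the product.\<close>

lemma gen_fun_continuation_real_branch_points:
  fixes \<alpha> :: real and u :: "nat \<Rightarrow> real"
  assumes u1: "u 1 = 1"
    and u: "\<And>n. n \<ge> 2 \<Longrightarrow> u n = \<alpha> * u (n - 1) + (\<Sum>j = 1..n - 1. u j * u (n - j))"
    and \<alpha>: "\<alpha> \<ge> -1"
  obtains G where "continues_gen_fun u G" "G holomorphic_on slit_plane"
    "((\<lambda>z. z * G z) \<longlongrightarrow> of_real ((\<alpha> - \<bar>\<alpha>\<bar>) / 2)) (at 0 within slit_plane)"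
proof -
  define s where "s = sqrt (1 + \<alpha>)"
  have s2: "s * s = 1 + \<alpha>" using \<alpha> by (simp add: s_def)
  \<comment> \<open>-a and -b are the roots of (z + \<alpha>)^2 + 4z, which gives their sum and
    product below.\<close>
  define a where "a = (1 + s) * (1 + s)"
  define b where "b = (1 - s) * (1 - s)"
  have ab: "a \<ge> 0" "b \<ge> 0" by (simp_all add: a_def b_def)
  have ab_eq: "a + b = 2 * \<alpha> + 4" "a * b = \<alpha> * \<alpha>"
    using s2 unfolding a_def b_def by algebra+
  \<comment> \<open>Both roots equal 1 at w = 0, so the minus sign selects the branch vanishing
    there.\<close>
  define g where "g = (\<lambda>w. (1 - of_real \<alpha> * w -
    csqrt (1 - complex_of_real a * w) * csqrt (1 - complex_of_real b * w)) / 2)"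
  define G where "G = (\<lambda>z. g (-1/z))"
  have G: "G z = (1 + of_real \<alpha> / z -
      csqrt (1 + complex_of_real a / z) * csqrt (1 + complex_of_real b / z)) / 2" for z
    by (simp add: G_def g_def)
  have hol: "G holomorphic_on slit_plane"
    unfolding G by (intro holomorphic_intros) (auto simp: ab add_nonneg_notin_nonpos_Reals)
  have gan: "g analytic_on {0}"
    unfolding g_def by (intro analytic_intros) auto
  have "g w = w + of_real \<alpha> * (w * g w) + g w * g w" for w
  proof -
    define p q where "p = csqrt (1 - complex_of_real a * w)" and "q = csqrt (1 - complex_of_real b * w)"
    have pq: "p * p = 1 - complex_of_real a * w" "q * q = 1 - complex_of_real b * w"
      by (simp_all add: p_def q_def flip: power2_eq_square)
    have e: "complex_of_real a + complex_of_real b = 2 * of_real \<alpha> + 4" 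
      "complex_of_real a * complex_of_real b = of_real \<alpha> * of_real \<alpha>"
      using arg_cong[OF ab_eq(1), of complex_of_real] arg_cong[OF ab_eq(2), of complex_of_real]
      by simp_all
    have sq: "(p * q) * (p * q) = (1 - of_real \<alpha> * w) * (1 - of_real \<alpha> * w) - 4 * w"
      using pq e by algebra
    have "2 * g w = 1 - of_real \<alpha> * w - p * q"
      by (simp add: g_def p_def q_def)
    hence "4 * g w = 4 * (w + of_real \<alpha> * (w * g w) + g w * g w)"
      using sq by algebra
    thus ?thesis by (simp only: mult_cancel_left) simp
  qed
  hence "\<forall>\<^sub>F z in at_infinity.
    (\<lambda>n. (-1) ^ Suc n * complex_of_real (u (Suc n)) / z ^ Suc n) sums g (-1/z)"
    by (intro eventually_sums_quadratic_branch[OF u1 u gan]) (simp_all add: g_def)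
  moreover have "open slit_plane" by (simp add: open_Compl)
  hence "G nicely_meromorphic_on slit_plane"
    using hol analytic_on_open analytic_on_imp_nicely_meromorphic_on by blast
  ultimately have "continues_gen_fun u G"
    unfolding continues_gen_fun_def G_def by (auto elim: eventually_mono)
  moreover have "((\<lambda>z. z * G z) \<longlongrightarrow> of_real ((\<alpha> - \<bar>\<alpha>\<bar>) / 2)) (at 0 within slit_plane)"
  proof -
    have "((\<lambda>z. (z + of_real \<alpha> - csqrt (z + of_real a) * csqrt (z + of_real b)) / 2)
      \<longlongrightarrow> (0 + of_real \<alpha> - of_real (sqrt a) * of_real (sqrt b)) / 2) (at 0)"
      by (intro tendsto_intros tendsto_csqrt_add_nonneg ab) auto
    \<comment> \<open>From ab = \<alpha>^2 one gets sqrt a * sqrt b = |\<alpha>|; the sign of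
      \<alpha> now decides whether the limit vanishes.\<close>
    also have "(0 + of_real \<alpha> - of_real (sqrt a) * of_real (sqrt b)) / 2 =
        complex_of_real ((\<alpha> - \<bar>\<alpha>\<bar>) / 2)"
      using ab_eq(2) by (simp flip: of_real_mult real_sqrt_mult)
    finally have *: "((\<lambda>z. (z + of_real \<alpha> - csqrt (z + of_real a) * csqrt (z + of_real b)) / 2)
      \<longlongrightarrow> complex_of_real ((\<alpha> - \<bar>\<alpha>\<bar>) / 2)) (at 0 within slit_plane)"
      by (rule tendsto_within_subset) simp
    \<comment> \<open>Write z as the square of \<open>csqrt z\<close> and give one factor to each
      root.\<close>
    have "z * G z = (z + of_real \<alpha> - csqrt (z + of_real a) * csqrt (z + of_real b)) / 2"
      if "z \<in> slit_plane" for z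
    proof -
      have z: "z \<notin> \<real>\<^sub>\<le>\<^sub>0" "z \<noteq> 0" using that by auto
      have "csqrt z * csqrt z = z" by (simp flip: power2_eq_square)
      hence "csqrt (z + of_real a) * csqrt (z + of_real b) =
        z * (csqrt (1 + complex_of_real a / z) * csqrt (1 + complex_of_real b / z))"
        unfolding csqrt_add_nonneg[OF z(1) ab(1)] csqrt_add_nonneg[OF z(1) ab(2)]
        by (metis mult.assoc mult.left_commute)
      thus ?thesis using z(2) unfolding G by (simp add: algebra_simps add_divide_distrib diff_divide_distrib)
    qed
    hence "\<forall>\<^sub>F z in at 0 within slit_plane. (z + of_real \<alpha> - csqrt (z + of_real a) * csqrt (z + of_real b)) / 2 = z * G z"
      by (simp add: eventually_at_filter)
    from Lim_transform_eventually[OF * this] show ?thesis .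
  qed
  ultimately show ?thesis using that hol by blast
qed

section \<open>Branch points and the case \<alpha> < -1\<close>

lemma connected_slit_plane: "connected slit_plane"
proof -
  have "\<real>\<^sub>\<le>\<^sub>0 = complex_of_real ` {..0}"
    by (auto simp: nonpos_Reals_def)
  thus ?thesis
    using starlike_slotted_complex_plane_left[of 0] starlike_imp_connected by simp
qed

text \<open>The identity holds for large z by the power series and spreads over the connected slit
  plane by the identity theorem for meromorphic functions. It is stated on punctured neighbourhoods
  because poles of \<open>G\<close> are not yet excluded.\<close>

lemma gen_fun_continuation_quadratic:
  fixes \<alpha> :: real and u :: "nat \<Rightarrow> real"
  assumes u1: "u 1 = 1"
    and u: "\<And>n. n \<ge> 2 \<Longrightarrow> u n = \<alpha> * u (n - 1) + (\<Sum>j = 1..n - 1. u j * u (n - j))"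
    and G: "continues_gen_fun u G" and p: "p \<in> slit_plane"
  shows "\<forall>\<^sub>F z in at p. (2 * z * G z - z - of_real \<alpha>)\<^sup>2 = (z + of_real \<alpha>)\<^sup>2 + 4 * z"
proof -
  let ?E = "\<lambda>z. (2 * z * G z - z - of_real \<alpha>)\<^sup>2 - ((z + of_real \<alpha>)\<^sup>2 + 4 * z)"
  have op: "open slit_plane" by (simp add: open_Compl)
  \<comment> \<open>A single root is enough here: its radicand is 1 at w = 0 for every real
    \<alpha>, and only the germ at 0 matters.\<close>
  define g where "g = (\<lambda>w. (1 - of_real \<alpha> * w - csqrt ((1 - of_real \<alpha> * w)\<^sup>2 - 4 * w)) / 2)"
  have gan: "g analytic_on {0}"
    unfolding g_def by (intro analytic_intros) auto
  have sq: "(2 * g w - (1 - of_real \<alpha> * w))\<^sup>2 = (1 - of_real \<alpha> * w)\<^sup>2 - 4 * w" for w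
  proof -
    have "2 * g w - (1 - of_real \<alpha> * w) = - csqrt ((1 - of_real \<alpha> * w)\<^sup>2 - 4 * w)"
      by (simp add: g_def field_simps)
    thus ?thesis by simp
  qed
  have "g w = w + of_real \<alpha> * (w * g w) + g w * g w" for w
  proof -
    have "4 * g w = 4 * (w + of_real \<alpha> * (w * g w) + g w * g w)"
      using sq[of w] by algebra
    thus ?thesis by (simp only: mult_cancel_left) simp
  qed
  hence "\<forall>\<^sub>F z in at_infinity.
    (\<lambda>n. (-1) ^ Suc n * complex_of_real (u (Suc n)) / z ^ Suc n) sums g (-1/z)"
    by (intro eventually_sums_quadratic_branch[OF u1 u gan]) (simp_all add: g_def)
  moreover have "\<forall>\<^sub>F z in at_infinity. z \<in> slit_plane \<longrightarrow>
        (\<lambda>n. (-1) ^ Suc n * complex_of_real (u (Suc n)) / z ^ Suc n) sums G z"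
    using G by (simp add: continues_gen_fun_def)
  ultimately have "\<forall>\<^sub>F z in at_infinity. z \<in> slit_plane \<longrightarrow> ?E z = 0"
  proof eventually_elim
    case (elim z)
    show ?case
    proof
      assume z: "z \<in> slit_plane"
      hence z0: "z \<noteq> 0" by auto
      have "G z = g (-1/z)" using elim z sums_unique2 by blast
      hence "(2 * G z - (1 + of_real \<alpha> / z))\<^sup>2 = (1 + of_real \<alpha> / z)\<^sup>2 + 4 / z"
        using sq[of "-1/z"] by simp
      hence "(z * (2 * G z - (1 + of_real \<alpha> / z)))\<^sup>2 = (z * (1 + of_real \<alpha> / z))\<^sup>2 + z\<^sup>2 * (4 / z)"
        by (simp only: power_mult_distrib flip: distrib_left)
      moreover have "z * (2 * G z - (1 + of_real \<alpha> / z)) = 2 * z * G z - z - of_real \<alpha>"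
        "z * (1 + of_real \<alpha> / z) = z + of_real \<alpha>" "z\<^sup>2 * (4 / z) = 4 * z"
        using z0 by (simp_all add: field_simps power2_eq_square)
      ultimately show "?E z = 0" by simp
    qed
  qed
  then obtain B where B: "\<And>z. norm z \<ge> B \<Longrightarrow> z \<in> slit_plane \<Longrightarrow> ?E z = 0"
    by (auto simp: eventually_at_infinity)
  \<comment> \<open>A point of the positive axis beyond \<open>B\<close>; the identity holds in a
    neighbourhood of it, which excludes the alternative that \<open>?E\<close> avoids 0 off a sparse
    set.\<close>
  define z1 where "z1 = complex_of_real (\<bar>B\<bar> + 1)"
  have z1: "z1 \<in> slit_plane" by (simp add: z1_def complex_nonpos_Reals_iff)
  have "\<forall>\<^sub>F z in at z1. z \<in> slit_plane \<inter> {z. norm z > B}"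
    by (rule eventually_at_in_open')
       (use z1 op in \<open>auto simp: z1_def intro!: open_Int open_Collect_less continuous_intros\<close>)
  hence ev1: "\<forall>\<^sub>F z in at z1. ?E z = 0"
    by eventually_elim (use B in auto)
  have "?E meromorphic_on slit_plane"
    using G by (intro meromorphic_intros) (auto simp: continues_gen_fun_def nicely_meromorphic_on_def)
  from meromorphic_imp_constant_or_avoid[OF this op connected_slit_plane, of 0]
  have "\<forall>\<^sub>\<approx>x\<in>slit_plane. ?E x = 0"
  proof
    assume "\<forall>\<^sub>\<approx>x\<in>slit_plane. ?E x \<noteq> 0"
    hence "\<forall>\<^sub>F z in at z1. ?E z \<noteq> 0"
      using z1 eventually_cosparse_imp_eventually_at by blast
    with ev1 have "\<forall>\<^sub>F z in at z1. False" by eventually_elim simp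
    thus ?thesis by simp
  qed
  hence "\<forall>\<^sub>F z in at p. ?E z = 0"
    using p eventually_cosparse_imp_eventually_at by blast
  thus ?thesis by eventually_elim simp
qed

text \<open>Near p the polynomial \<open>?Q\<close> is the square of \<open>?H\<close>. Since
  \<open>?Q\<close> vanishes at p, \<open>?H\<close> tends to 0 there, so \<open>G\<close> has no
  pole and \<open>?H\<close> is analytic at p. Differentiating the square at a zero of
  \<open>?H\<close> gives Q'(p) = 0, so p is a double root.\<close>

lemma gen_fun_continuation_no_branch_point:
  fixes \<alpha> :: real and u :: "nat \<Rightarrow> real"
  assumes u1: "u 1 = 1"
    and u: "\<And>n. n \<ge> 2 \<Longrightarrow> u n = \<alpha> * u (n - 1) + (\<Sum>j = 1..n - 1. u j * u (n - j))"
    and G: "continues_gen_fun u G" and p: "p \<in> slit_plane"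
    and root: "(p + of_real \<alpha>)\<^sup>2 + 4 * p = 0"
  shows "p + of_real \<alpha> + 2 = 0"
proof -
  let ?H = "\<lambda>z. 2 * z * G z - z - of_real \<alpha>" and ?Q = "\<lambda>z::complex. (z + of_real \<alpha>)\<^sup>2 + 4 * z"
  have ev: "\<forall>\<^sub>F z in at p. (?H z)\<^sup>2 = ?Q z"
    by (rule gen_fun_continuation_quadratic[OF u1 u G p])
  have p0: "p \<noteq> 0" using p by auto
  have "(?Q \<longlongrightarrow> ?Q p) (at p)" by (intro tendsto_intros)
  hence "((\<lambda>z. (?H z)\<^sup>2) \<longlongrightarrow> 0) (at p)"
    using tendsto_cong[OF ev] root by simp
  from tendsto_real_sqrt[OF tendsto_norm[OF this]]
  have "((\<lambda>z. norm (?H z)) \<longlongrightarrow> 0) (at p)" by (simp add: norm_power)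
  hence H0: "(?H \<longlongrightarrow> 0) (at p)" by (rule tendsto_norm_zero_cancel)
  have "((\<lambda>z. (?H z + z + of_real \<alpha>) / (2 * z)) \<longlongrightarrow> (0 + p + of_real \<alpha>) / (2 * p)) (at p)"
    by (intro tendsto_intros H0) (use p0 in auto)
  moreover have "\<forall>\<^sub>F z in at p. z \<in> - {0}"
    by (rule eventually_at_in_open') (use p0 in auto)
  hence "\<forall>\<^sub>F z in at p. (?H z + z + of_real \<alpha>) / (2 * z) = G z"
    by eventually_elim (auto simp: field_simps)
  ultimately have "(G \<longlongrightarrow> (0 + p + of_real \<alpha>) / (2 * p)) (at p)"
    by (rule Lim_transform_eventually)
  hence "\<not> is_pole G p"
    unfolding is_pole_def using not_tendsto_and_filterlim_at_infinity trivial_limit_at by blast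
  \<comment> \<open>Nice meromorphy ensures that the value at a point that is not a pole agrees with
    the limit.\<close>
  hence "G analytic_on {p}"
    using G p nicely_meromorphic_on_imp_analytic_at by (auto simp: continues_gen_fun_def)
  hence Han: "?H analytic_on {p}" by (intro analytic_intros)
  hence "(?H \<longlongrightarrow> ?H p) (at p)" using analytic_at_imp_isCont isContD by blast
  hence Hp: "?H p = 0" using H0 tendsto_unique trivial_limit_at by blast
  obtain D where D: "(?H has_field_derivative D) (at p)"
    using Han analytic_on_imp_differentiable_at field_differentiable_def by blast
  have "((\<lambda>z. (?H z)\<^sup>2) has_field_derivative 0) (at p)"
    using DERIV_power[OF D, of 2] Hp by simp
  \<comment> \<open>Both sides vanish at p, so the punctured identity extends to p.\<close>
  moreover have "\<forall>\<^sub>F z in nhds p. (?H z)\<^sup>2 = ?Q z"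
    using ev Hp root unfolding eventually_nhds_conv_at by simp
  ultimately have "(?Q has_field_derivative 0) (at p)"
    by (simp only: DERIV_cong_ev[OF refl _ refl])
  moreover have "(?Q has_field_derivative (2 * (p + of_real \<alpha>) + 4)) (at p)"
    by (auto intro!: derivative_eq_intros)
  ultimately have "2 * (p + of_real \<alpha>) + 4 = 0" using DERIV_unique by blast
  hence "2 * (p + of_real \<alpha> + 2) = 0" by (simp add: algebra_simps)
  thus ?thesis by (metis mult_eq_0_iff zero_neq_numeral)
qed

text \<open>Already the meromorphic continuation fails, whatever the behaviour at 0.\<close>

lemma not_continues_gen_fun:
  fixes \<alpha> :: real and u :: "nat \<Rightarrow> real"
  assumes u1: "u 1 = 1"
    and u: "\<And>n. n \<ge> 2 \<Longrightarrow> u n = \<alpha> * u (n - 1) + (\<Sum>j = 1..n - 1. u j * u (n - j))"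
    and \<alpha>: "\<alpha> < -1"
  shows "\<not> continues_gen_fun u G"
proof
  assume G: "continues_gen_fun u G"
  define t where "t = sqrt (- 1 - \<alpha>)"
  have t: "t > 0" "t * t = - 1 - \<alpha>" using \<alpha> by (simp_all add: t_def)
  \<comment> \<open>This is -(1 - it)^2, a branch point off the real axis; p + \<alpha> + 2 = 2it is
    nonzero, so the root is simple.\<close>
  define p where "p = Complex (- 2 - \<alpha>) (2 * t)"
  have "p \<in> slit_plane" using t by (simp add: p_def complex_nonpos_Reals_iff)
  moreover have "(p + of_real \<alpha>)\<^sup>2 + 4 * p = 0"
    using t by (simp add: p_def complex_eq_iff power2_eq_square algebra_simps)
  ultimately have "p + of_real \<alpha> + 2 = 0"
    using gen_fun_continuation_no_branch_point[OF u1 u G] by blast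
  thus False using t by (simp add: p_def complex_eq_iff)
qed

theorem mainTheorem7:
  fixes \<alpha> :: real and u :: "nat \<Rightarrow> real"
  assumes "u 1 = 1"
    and "\<And>n. n \<ge> 2 \<Longrightarrow> u n = \<alpha> * u (n - 1) + (\<Sum>j = 1..n - 1. u j * u (n - j))"
  shows "(\<alpha> \<ge> 0 \<longrightarrow> regular_seq u) \<and>
         (-1 \<le> \<alpha> \<and> \<alpha> < 0 \<longrightarrow> quasiregular_seq u) \<and>
         (\<alpha> < -1 \<longrightarrow> \<not> simply_represented u)"
proof (cases "\<alpha> \<ge> -1")
  case True
  obtain G where G: "continues_gen_fun u G" "G holomorphic_on slit_plane"
    "((\<lambda>z. z * G z) \<longlongrightarrow> of_real ((\<alpha> - \<bar>\<alpha>\<bar>) / 2)) (at 0 within slit_plane)"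
    using gen_fun_continuation_real_branch_points[OF assms True] by blast
  \<comment> \<open>Without poles, the condition on pole orders holds vacuously.\<close>
  have "\<not> is_pole G p" if "p \<in> slit_plane" for p
    using that G(2) not_is_pole_holomorphic[of slit_plane p G] by (simp add: open_Compl)
  hence sr: "simply_represented u"
    unfolding simply_represented_def using G by blast
  have "regular_seq u" if "\<alpha> \<ge> 0"
    unfolding regular_seq_def using sr G that by auto
  moreover have "quasiregular_seq u" if "\<alpha> < 0"
  proof -
    \<comment> \<open>For \<alpha> < 0 the limit (\<alpha> - |\<alpha>|)/2 is \<alpha>
      itself.\<close>
    have "\<not> ((\<lambda>z. z * G z) \<longlongrightarrow> 0) (at 0 within slit_plane)"
    proof
      assume "((\<lambda>z. z * G z) \<longlongrightarrow> 0) (at 0 within slit_plane)"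
      from tendsto_unique[OF at_0_within_slit_plane_neq_bot this G(3)]
      show False using that by (simp flip: of_real_diff)
    qed
    thus ?thesis unfolding quasiregular_seq_def using sr G(1) by blast
  qed
  ultimately show ?thesis using True by auto
next
  case False
  thus ?thesis
    using not_continues_gen_fun[OF assms] by (auto simp: simply_represented_def)
qed

end
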